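(* Assume there exist $\lambda_0>0$ and strictly positive functions $\psi_0\in\mathrm{Dom}(L)$, $\phi_0\in\mathrm{Dom}(L^* )$ with $\int_D\psi_0\,dx=\int_D\phi_0\,dx=1$ such that, for all $t\ge 0$, $P^D_t\psi_0=e^{-\lambda_0t}\psi_0$, $(P^D)^*_t\phi_0=e^{-\lambda_0t}\phi_0$, hence $(L+\lambda_0)\psi_0=(L^*+\lambda_0)\phi_0=0$. Let $g(z)\ge Cz^{1+\beta}$ for all $z>0$, where $C>0$, $\beta>0$ are given constants. Define $$\tau^*=\inf\Big\{t>0:\int_0^t\exp\big[-\beta(\lambda_0K(r)+A(r))+\beta N_r\big]\,dr\ \ge\ \frac1{C\beta}\langle\varphi,\phi_0\rangle_D^{-\beta}\Big\}.$$ Then, on the event $\{\tau^*<\infty\}$, the solution $v$ of $$\frac{\partial v}{\partial t}=\tfrac12k^2(t)Lv-\tfrac12a^2(t)v+e^{-N_t}g(e^{N_t}v),\quad v(\cdot,0)=\varphi,\quad v=0\text{ on }\partial D,$$ and the solution $u$ of $$du(x,t)=\big[\tfrac12k^2(t)Lu(x,t)+g(u(x,t))\big]dt+u(x,t)\,dN_t,\quad u(\cdot,0)=\varphi,\quad u=0\text{ on }\partial D,$$ blow up in finite time $\tau$, and $\tau\le\tau^*$ $\mathbb P$-a.s.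
   Context: $D\subset\mathbb{R}^d$ is a bounded Lipschitz domain, $\langle\cdot,\cdot\rangle_D$ the scalar product of $L^2(D)$. $L$ is the infinitesimal generator of a strongly continuous semigroup of contractions $(P^D_t)_{t\ge0}$ on $L^2(D)$ with adjoint $L^*$ generating $((P^D)^*_t)_{t\ge0}$; the associated transition functions admit continuous densities $p^D(t,x,y)$ and $(p^D)^*(t,x,y)=p^D(t,y,x)$ on $D\times D$, $t>0$. $\varphi\in L^\infty(D)$, $\varphi\ge0$; $g:\mathbb{R}\to[0,\infty)$ is locally Lipschitz. On a filtered probability space $(\Omega,\mathcal F,(\mathcal F_t)_{t\ge0},\mathbb P)$, $B$ is a Brownian motion and $B^H$ a fractional Brownian motion with Hurst parameter $H\in(1/2,1)$, both adapted. $a$ is continuous, $b$ is Hölder continuous of order $\alpha>1-H$, $k$ is a real function on $[0,\infty)$ with $\int_0^tk^2(r)\,dr<\infty$ for all $t$, and $N_t=\int_0^t a(s)\,dB_s+\int_0^t b(s)\,dB^H_s$ (Itô integral plus fractional, i.e. generalized Riemann–Stieltjes, integral). $K(t)=\frac12\int_0^tk^2(r)\,dr$, $A(t)=\frac12\int_0^ta^2(r)\,dr$. A blowup time $\tau$ of a solution $u$ is a stopping time with $\limsup_{t\nearrow\tau}\sup_{x\in D}|u(x,t)|=+\infty$ $\mathbb P$-a.s.; $\tau(\omega)=\infty$ if there is no blowup in finite time. The solutions $u$ and $v$ are related by $v(x,t)=e^{-N_t}u(x,t)$, so they have the same blowup time. Solutions are weak solutions up to $\tau$: adapted $L^2(D)$-valued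 random fields such that, for all $t\in(0,T\wedge\tau)$ ($T>0$ arbitrary) and $f\in\mathrm{Dom}(L^* )$, $\mathbb P$-a.s., for $v$: $$\langle v(\cdot,t),f\rangle_D=\langle\varphi,f\rangle_D+\int_0^t\Big(\tfrac12k^2(s)\langle v(\cdot,s),L^*f\rangle_D-\tfrac12a^2(s)\langle v(\cdot,s),f\rangle_D\Big)ds+\int_0^te^{-N_s}\langle g(e^{N_s}v(\cdot,s)),f\rangle_D\,ds;$$ for $u$: (i) $\int_0^ta^2(s)[1+\langle u(\cdot,s),f\rangle_D^2]\,ds<\infty$ and $s\mapsto b(s)\langle u(\cdot,s),f\rangle_D$ is Hölder continuous on $[0,t]$ of some order $\gamma>1-H$; (ii) $\int_0^t(k^2(s)|\langle u(\cdot,s),L^*f\rangle_D|+|\langle g(u(\cdot,s)),f\rangle_D|)ds<\infty$; and $$\langle u(\cdot,t),f\rangle_D=\langle\varphi,f\rangle_D+\int_0^t\Big(\tfrac12k^2(s)\langle u(\cdot,s),L^*f\rangle_D+\langle g(u(\cdot,s)),f\rangle_D\Big)ds+\int_0^t\langle u(\cdot,s),f\rangle_D\,dN_s.$$ Conventions: $\inf\emptyset=+\infty$, and $0^{-\beta}=+\infty$. *)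

theory Defs
  imports "HOL-Probability.Probability"
begin

section \<open>The domain and the space of square integrable functions\<close>

text \<open>Near every boundary point \<open>D\<close> is the strict epigraph of a Lipschitz function \<open>\<gamma>\<close> over the
  hyperplane orthogonal to the unit vector \<open>e\<close>.\<close>

definition lipschitz_domain :: "'a::euclidean_space set \<Rightarrow> bool" where
  "lipschitz_domain D \<longleftrightarrow> open D \<and> connected D \<and> D \<noteq> {} \<and>
     (\<forall>q\<in>frontier D. \<exists>r>0. \<exists>e \<gamma>. \<exists>c. norm e = 1 \<and> c-lipschitz_on {y. y \<bullet> e = 0} \<gamma> \<and>
        D \<inter> ball q r = {x \<in> ball q r. \<gamma> (x - (x \<bullet> e) *\<^sub>R e) < x \<bullet> e})"

text \<open>Elements of \<open>L\<^sup>2(D)\<close> are represented by functions; only their values almost everywhere on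
  \<open>D\<close> are relevant.\<close>

definition L2 :: "'a::euclidean_space set \<Rightarrow> ('a \<Rightarrow> real) set" where
  "L2 D = {f. set_borel_measurable lborel D f \<and> set_integrable lborel D (\<lambda>x. (f x)\<^sup>2)}"

definition Linfty :: "'a::euclidean_space set \<Rightarrow> ('a \<Rightarrow> real) set" where
  "Linfty D = {f. set_borel_measurable lborel D f \<and> (\<exists>c. AE x\<in>D in lborel. \<bar>f x\<bar> \<le> c)}"

definition L2_inner :: "'a::euclidean_space set \<Rightarrow> ('a \<Rightarrow> real) \<Rightarrow> ('a \<Rightarrow> real) \<Rightarrow> real" where
  "L2_inner D f h = (LINT x:D|lborel. f x * h x)"

definition L2_norm :: "'a::euclidean_space set \<Rightarrow> ('a \<Rightarrow> real) \<Rightarrow> real" where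
  "L2_norm D f = sqrt (L2_inner D f f)"

definition eq_ae :: "'a::euclidean_space set \<Rightarrow> ('a \<Rightarrow> real) \<Rightarrow> ('a \<Rightarrow> real) \<Rightarrow> bool" where
  "eq_ae D f h \<longleftrightarrow> (AE x\<in>D in lborel. f x = h x)"

section \<open>Semigroups, generators, transition densities\<close>

text \<open>Compatibility with almost everywhere equality follows from linearity and contractivity.\<close>

definition contraction_semigroup ::
    "'a::euclidean_space set \<Rightarrow> (real \<Rightarrow> ('a \<Rightarrow> real) \<Rightarrow> ('a \<Rightarrow> real)) \<Rightarrow> bool" where
  "contraction_semigroup D P \<longleftrightarrow>
     (\<forall>t\<ge>0. \<forall>f\<in>L2 D. P t f \<in> L2 D \<and> L2_norm D (P t f) \<le> L2_norm D f) \<and>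
     (\<forall>t\<ge>0. \<forall>f\<in>L2 D. \<forall>h\<in>L2 D. \<forall>c.
        eq_ae D (P t (\<lambda>x. f x + c * h x)) (\<lambda>x. P t f x + c * P t h x)) \<and>
     (\<forall>f\<in>L2 D. eq_ae D (P 0 f) f) \<and>
     (\<forall>s\<ge>0. \<forall>t\<ge>0. \<forall>f\<in>L2 D. eq_ae D (P (s + t) f) (P s (P t f))) \<and>
     (\<forall>f\<in>L2 D. ((\<lambda>t. L2_norm D (\<lambda>x. P t f x - f x)) \<longlongrightarrow> 0) (at_right 0))"

text \<open>Unbounded operators on \<open>L\<^sup>2(D)\<close> are given by their graphs: \<open>L f h\<close> means that \<open>f\<close> is in the
  domain of \<open>L\<close> and that \<open>h\<close> represents \<open>L f\<close>.\<close>

definition generator ::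
    "'a::euclidean_space set \<Rightarrow> (real \<Rightarrow> ('a \<Rightarrow> real) \<Rightarrow> ('a \<Rightarrow> real)) \<Rightarrow>
     ('a \<Rightarrow> real) \<Rightarrow> ('a \<Rightarrow> real) \<Rightarrow> bool" where
  "generator D P f h \<longleftrightarrow> f \<in> L2 D \<and> h \<in> L2 D \<and>
     ((\<lambda>t. L2_norm D (\<lambda>x. (P t f x - f x) / t - h x)) \<longlongrightarrow> 0) (at_right 0)"

definition adjoint_op ::
    "'a::euclidean_space set \<Rightarrow> (('a \<Rightarrow> real) \<Rightarrow> ('a \<Rightarrow> real) \<Rightarrow> bool) \<Rightarrow>
     ('a \<Rightarrow> real) \<Rightarrow> ('a \<Rightarrow> real) \<Rightarrow> bool" where
  "adjoint_op D L f h \<longleftrightarrow> f \<in> L2 D \<and> h \<in> L2 D \<and>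
     (\<forall>\<psi> \<eta>. L \<psi> \<eta> \<longrightarrow> L2_inner D \<eta> f = L2_inner D \<psi> h)"

definition op_dom :: "(('a \<Rightarrow> real) \<Rightarrow> ('a \<Rightarrow> real) \<Rightarrow> bool) \<Rightarrow> ('a \<Rightarrow> real) set" where
  "op_dom L = {f. \<exists>h. L f h}"

text \<open>The kernels \<open>p t x y dy\<close> form a (sub-Markovian) transition function on \<open>D\<close> with continuous
  densities, and the semigroup acts by integration against them.\<close>

definition transition_density ::
    "'a::euclidean_space set \<Rightarrow> (real \<Rightarrow> ('a \<Rightarrow> real) \<Rightarrow> ('a \<Rightarrow> real)) \<Rightarrow>
     (real \<Rightarrow> 'a \<Rightarrow> 'a \<Rightarrow> real) \<Rightarrow> bool" where
  "transition_density D P p \<longleftrightarrow>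
     (\<forall>t>0. continuous_on (D \<times> D) (\<lambda>(x, y). p t x y)) \<and>
     (\<forall>t>0. \<forall>x\<in>D. \<forall>y\<in>D. 0 \<le> p t x y) \<and>
     (\<forall>t>0. \<forall>x\<in>D. (\<integral>\<^sup>+y\<in>D. ennreal (p t x y) \<partial>lborel) \<le> 1) \<and>
     (\<forall>s>0. \<forall>t>0. \<forall>x\<in>D. AE z\<in>D in lborel.
        ennreal (p (s + t) x z) = (\<integral>\<^sup>+y\<in>D. ennreal (p s x y * p t y z) \<partial>lborel)) \<and>
     (\<forall>t>0. \<forall>f\<in>L2 D. AE x\<in>D in lborel.
        set_integrable lborel D (\<lambda>y. p t x y * f y) \<and> P t f x = (LINT y:D|lborel. p t x y * f y))"

section \<open>Brownian and fractional Brownian motion\<close>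

text \<open>Processes are indexed by \<open>real\<close>, but only times \<open>t \<ge> 0\<close> are relevant. The indexing of a
  filtration by all reals is no restriction: put \<open>F t = F 0\<close> for \<open>t < 0\<close>.\<close>

definition filtered_prob_space :: "'w measure \<Rightarrow> (real \<Rightarrow> 'w measure) \<Rightarrow> bool" where
  "filtered_prob_space M F \<longleftrightarrow> prob_space M \<and> filtration (space M) F \<and> (\<forall>t. subalgebra M (F t))"

definition adapted :: "(real \<Rightarrow> 'w measure) \<Rightarrow> (real \<Rightarrow> 'w \<Rightarrow> real) \<Rightarrow> bool" where
  "adapted F X \<longleftrightarrow> (\<forall>t\<ge>0. X t \<in> borel_measurable (F t))"

definition continuous_paths :: "'w measure \<Rightarrow> (real \<Rightarrow> 'w \<Rightarrow> real) \<Rightarrow> bool" where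
  "continuous_paths M X \<longleftrightarrow> (AE \<omega> in M. continuous_on {0..} (\<lambda>t. X t \<omega>))"

definition brownian_motion ::
    "'w measure \<Rightarrow> (real \<Rightarrow> 'w measure) \<Rightarrow> (real \<Rightarrow> 'w \<Rightarrow> real) \<Rightarrow> bool" where
  "brownian_motion M F B \<longleftrightarrow> adapted F B \<and> continuous_paths M B \<and> (AE \<omega> in M. B 0 \<omega> = 0) \<and>
     (\<forall>s t. 0 \<le> s \<and> s < t \<longrightarrow>
        distributed M lborel (\<lambda>\<omega>. B t \<omega> - B s \<omega>) (\<lambda>x. ennreal (normal_density 0 (sqrt (t - s)) x)) \<and>
        prob_space.indep_set M (sets (F s))
          (sets (vimage_algebra (space M) (\<lambda>\<omega>. B t \<omega> - B s \<omega>) borel)))"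

text \<open>Degenerate (constant) Gaussian variables are allowed.\<close>

definition gaussian_rv :: "'w measure \<Rightarrow> ('w \<Rightarrow> real) \<Rightarrow> bool" where
  "gaussian_rv M X \<longleftrightarrow> X \<in> borel_measurable M \<and>
     ((\<exists>\<mu>. AE \<omega> in M. X \<omega> = \<mu>) \<or>
      (\<exists>\<mu> \<sigma>. 0 < \<sigma> \<and> distributed M lborel X (\<lambda>x. ennreal (normal_density \<mu> \<sigma> x))))"

definition gaussian_process :: "'w measure \<Rightarrow> (real \<Rightarrow> 'w \<Rightarrow> real) \<Rightarrow> bool" where
  "gaussian_process M X \<longleftrightarrow>
     (\<forall>n (r::nat \<Rightarrow> real) c. (\<forall>i<n. 0 \<le> r i) \<longrightarrow> gaussian_rv M (\<lambda>\<omega>. \<Sum>i<n. c i * X (r i) \<omega>))"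

definition fractional_brownian_motion :: "'w measure \<Rightarrow> real \<Rightarrow> (real \<Rightarrow> 'w \<Rightarrow> real) \<Rightarrow> bool" where
  "fractional_brownian_motion M H X \<longleftrightarrow> gaussian_process M X \<and> continuous_paths M X \<and>
     (\<forall>t\<ge>0. (\<integral>\<omega>. X t \<omega> \<partial>M) = 0) \<and>
     (\<forall>s\<ge>0. \<forall>t\<ge>0. (\<integral>\<omega>. X s \<omega> * X t \<omega> \<partial>M) =
        (s powr (2 * H) + t powr (2 * H) - \<bar>t - s\<bar> powr (2 * H)) / 2)"

section \<open>The Ito integral\<close>

text \<open>The list entry \<open>(r, t, \<xi>)\<close> stands for the elementary integrand \<open>\<xi> \<cdot> 1\<^bsub>(r, t]\<^esub>\<close>.\<close>

type_synonym 'w simple_process = "(real \<times> real \<times> ('w \<Rightarrow> real)) list"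

definition simple_adapted :: "(real \<Rightarrow> 'w measure) \<Rightarrow> 'w simple_process \<Rightarrow> bool" where
  "simple_adapted F S \<longleftrightarrow> (\<forall>(r, t, \<xi>)\<in>set S. 0 \<le> r \<and> r \<le> t \<and>
     \<xi> \<in> borel_measurable (F r) \<and> (\<exists>c. \<forall>\<omega>\<in>space (F r). \<bar>\<xi> \<omega>\<bar> \<le> c))"

definition simple_value :: "'w simple_process \<Rightarrow> real \<Rightarrow> 'w \<Rightarrow> real" where
  "simple_value S s \<omega> = (\<Sum>(r, t, \<xi>)\<leftarrow>S. \<xi> \<omega> * indicator {r<..t} s)"

definition simple_integral_process ::
    "(real \<Rightarrow> 'w \<Rightarrow> real) \<Rightarrow> 'w simple_process \<Rightarrow> real \<Rightarrow> 'w \<Rightarrow> real" where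
  "simple_integral_process B S s \<omega> = (\<Sum>(r, t, \<xi>)\<leftarrow>S. \<xi> \<omega> * (B (min s t) \<omega> - B (min s r) \<omega>))"

text \<open>\<open>I t = \<integral>\<^sub>0\<^sup>t X dB\<close> for \<open>t < \<tau>\<close>, where the integrand needs to be defined on \<open>[0, \<tau>)\<close> only.
  This is the usual extension of the integral from simple integrands to adapted integrands with
  locally square integrable paths. Convergence in probability is expressed by almost sure
  convergence of a suitable (sub)sequence; the nonnegative integral excludes the default value 0
  of divergent integrals.\<close>

definition has_ito_integral ::
    "'w measure \<Rightarrow> (real \<Rightarrow> 'w measure) \<Rightarrow> (real \<Rightarrow> 'w \<Rightarrow> real) \<Rightarrow> ('w \<Rightarrow> ereal) \<Rightarrow>
     (real \<Rightarrow> 'w \<Rightarrow> real) \<Rightarrow> (real \<Rightarrow> 'w \<Rightarrow> real) \<Rightarrow> bool" where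
  "has_ito_integral M F B \<tau> X I \<longleftrightarrow>
     (\<forall>t\<ge>0. \<exists>S :: nat \<Rightarrow> 'w simple_process. (\<forall>n. simple_adapted F (S n)) \<and>
        (AE \<omega> in M. ereal t < \<tau> \<omega> \<longrightarrow>
           set_borel_measurable lborel {0..t} (\<lambda>s. X s \<omega>) \<and>
           (\<lambda>n. \<integral>\<^sup>+s\<in>{0..t}. ennreal ((simple_value (S n) s \<omega> - X s \<omega>)\<^sup>2) \<partial>lborel) \<longlonglongrightarrow> 0 \<and>
           uniform_limit {0..t} (\<lambda>n s. simple_integral_process B (S n) s \<omega>) (\<lambda>s. I s \<omega>) sequentially))"

section \<open>The generalized Riemann--Stieltjes integral\<close>

definition holder_on :: "real \<Rightarrow> real set \<Rightarrow> (real \<Rightarrow> real) \<Rightarrow> bool" where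
  "holder_on \<gamma> S f \<longleftrightarrow> 0 < \<gamma> \<and> (\<exists>c. \<forall>x\<in>S. \<forall>y\<in>S. \<bar>f x - f y\<bar> \<le> c * \<bar>x - y\<bar> powr \<gamma>)"

text \<open>Weyl--Marchaud derivatives on \<open>(l, r)\<close>: the left-sided one of order \<open>\<alpha>\<close> of \<open>f\<close>, and the
  right-sided one of order \<open>\<alpha>\<close> of \<open>h\<close> without its factor \<open>(-1) powr \<alpha>\<close>.\<close>

definition frac_deriv_left :: "real \<Rightarrow> real \<Rightarrow> (real \<Rightarrow> real) \<Rightarrow> real \<Rightarrow> real" where
  "frac_deriv_left \<alpha> l f x = 1 / Gamma (1 - \<alpha>) *
     (f x / (x - l) powr \<alpha> + \<alpha> * (LINT y:{l..x}|lborel. (f x - f y) / (x - y) powr (\<alpha> + 1)))"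

definition frac_deriv_right :: "real \<Rightarrow> real \<Rightarrow> (real \<Rightarrow> real) \<Rightarrow> real \<Rightarrow> real" where
  "frac_deriv_right \<alpha> r h x = 1 / Gamma (1 - \<alpha>) *
     (h x / (r - x) powr \<alpha> + \<alpha> * (LINT y:{x..r}|lborel. (h x - h y) / (y - x) powr (\<alpha> + 1)))"

text \<open>Zaehle's integral \<open>\<integral>\<^sub>l\<^sup>r f dh\<close> for Hoelder continuous functions with orders summing to more
  than 1. Its formal prefactor \<open>(-1)\<^sup>\<alpha>\<close> and the factor \<open>(-1)\<^bsup>1-\<alpha>\<^esup>\<close> of the right-sided derivative
  combine to the minus sign below. The value does not depend on the choice of \<open>\<alpha>\<close>.\<close>

definition has_frac_integral ::
    "(real \<Rightarrow> real) \<Rightarrow> (real \<Rightarrow> real) \<Rightarrow> real \<Rightarrow> real \<Rightarrow> real \<Rightarrow> bool" where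
  "has_frac_integral f h l r J \<longleftrightarrow>
     (\<exists>\<alpha> \<gamma> \<mu>. 0 < \<alpha> \<and> \<alpha> < 1 \<and> \<alpha> < \<gamma> \<and> 1 - \<alpha> < \<mu> \<and> holder_on \<gamma> {l..r} f \<and> holder_on \<mu> {l..r} h \<and>
        J = - (LINT x:{l..r}|lborel. frac_deriv_left \<alpha> l (\<lambda>y. f y - f l) x *
                                     frac_deriv_right (1 - \<alpha>) r (\<lambda>y. h y - h r) x)
            + f l * (h r - h l))"

section \<open>The noise, weak solutions and blowup\<close>

text \<open>\<open>N\<^sub>t = \<integral>\<^sub>0\<^sup>t a dB + \<integral>\<^sub>0\<^sup>t b dB\<^sup>H\<close>, in its version with continuous paths.\<close>

definition mixed_noise ::
    "'w measure \<Rightarrow> (real \<Rightarrow> 'w measure) \<Rightarrow> (real \<Rightarrow> 'w \<Rightarrow> real) \<Rightarrow> (real \<Rightarrow> 'w \<Rightarrow> real) \<Rightarrow>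
     (real \<Rightarrow> real) \<Rightarrow> (real \<Rightarrow> real) \<Rightarrow> (real \<Rightarrow> 'w \<Rightarrow> real) \<Rightarrow> bool" where
  "mixed_noise M F B BH a b N \<longleftrightarrow> continuous_paths M N \<and>
     (\<exists>I. has_ito_integral M F B (\<lambda>_. \<infinity>) (\<lambda>s _. a s) I \<and>
        (AE \<omega> in M. \<forall>t\<ge>0. \<exists>J. has_frac_integral b (\<lambda>s. BH s \<omega>) 0 t J \<and> N t \<omega> = I t \<omega> + J))"

definition half_sq_integral :: "(real \<Rightarrow> real) \<Rightarrow> real \<Rightarrow> real" where
  "half_sq_integral q t = (LINT r:{0..t}|lborel. (q r)\<^sup>2) / 2"

text \<open>The library notion of a stopping time needs the filtration to be indexed by the type of the
  stopping time, which has to contain \<open>\<infinity>\<close> here.\<close>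

definition ext_stopping_time :: "(real \<Rightarrow> 'w measure) \<Rightarrow> ('w \<Rightarrow> ereal) \<Rightarrow> bool" where
  "ext_stopping_time F \<tau> \<longleftrightarrow> (\<forall>t\<ge>0. Measurable.pred (F t) (\<lambda>\<omega>. \<tau> \<omega> \<le> ereal t))"

text \<open>Random fields \<open>u(x, t)\<close> are written \<open>u t \<omega> x\<close> and considered for \<open>0 \<le> t < \<tau> \<omega>\<close> only.
  Measurability of an \<open>L\<^sup>2(D)\<close>-valued map is weak measurability; as \<open>L\<^sup>2(D)\<close> is separable, this is
  Borel measurability (Pettis).\<close>

definition adapted_L2_field ::
    "'w measure \<Rightarrow> (real \<Rightarrow> 'w measure) \<Rightarrow> 'a::euclidean_space set \<Rightarrow> ('w \<Rightarrow> ereal) \<Rightarrow>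
     (real \<Rightarrow> 'w \<Rightarrow> 'a \<Rightarrow> real) \<Rightarrow> bool" where
  "adapted_L2_field M F D \<tau> u \<longleftrightarrow>
     (\<forall>t\<ge>0. (\<forall>\<omega>\<in>space M. ereal t < \<tau> \<omega> \<longrightarrow> u t \<omega> \<in> L2 D) \<and>
        (\<forall>f\<in>L2 D. (\<lambda>\<omega>. if ereal t < \<tau> \<omega> then L2_inner D (u t \<omega>) f else 0) \<in> borel_measurable (F t)))"

definition blows_up_at :: "'a set \<Rightarrow> (real \<Rightarrow> 'a \<Rightarrow> real) \<Rightarrow> real \<Rightarrow> bool" where
  "blows_up_at D w T \<longleftrightarrow> Limsup (at_left T) (\<lambda>t. SUP x\<in>D. ereal \<bar>w t x\<bar>) = \<infinity>"

definition blowup_time ::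
    "'w measure \<Rightarrow> (real \<Rightarrow> 'w measure) \<Rightarrow> 'a set \<Rightarrow> (real \<Rightarrow> 'w \<Rightarrow> 'a \<Rightarrow> real) \<Rightarrow> ('w \<Rightarrow> ereal) \<Rightarrow> bool"
  where
  "blowup_time M F D u \<tau> \<longleftrightarrow> ext_stopping_time F \<tau> \<and>
     (AE \<omega> in M. 0 < \<tau> \<omega> \<and>
        (\<tau> \<omega> < \<infinity> \<longrightarrow> blows_up_at D (\<lambda>t. u t \<omega>) (real_of_ereal (\<tau> \<omega>))))"

text \<open>Weak solutions up to \<open>\<tau>\<close> of \<open>\<partial>v/\<partial>t = k\<^sup>2/2 L v - a\<^sup>2/2 v + e\<^bsup>-N\<^esup> g(e\<^bsup>N\<^esup> v)\<close>, \<open>v(\<cdot>,0) = \<phi>\<close>, where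
  \<open>Ls\<close> is the graph of the adjoint of \<open>L\<close>; the Dirichlet condition is carried by \<open>L\<close>. The
  integrability conditions say that the integrals and scalar products in the equation exist.\<close>

definition weak_solution_random_pde ::
    "'w measure \<Rightarrow> (real \<Rightarrow> 'w measure) \<Rightarrow> 'a::euclidean_space set \<Rightarrow>
     (('a \<Rightarrow> real) \<Rightarrow> ('a \<Rightarrow> real) \<Rightarrow> bool) \<Rightarrow> (real \<Rightarrow> real) \<Rightarrow> (real \<Rightarrow> real) \<Rightarrow> (real \<Rightarrow> real) \<Rightarrow>
     (real \<Rightarrow> 'w \<Rightarrow> real) \<Rightarrow> ('a \<Rightarrow> real) \<Rightarrow> ('w \<Rightarrow> ereal) \<Rightarrow> (real \<Rightarrow> 'w \<Rightarrow> 'a \<Rightarrow> real) \<Rightarrow> bool" where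
  "weak_solution_random_pde M F D Ls k a g N \<phi> \<tau> v \<longleftrightarrow> adapted_L2_field M F D \<tau> v \<and>
     (\<forall>T>0. \<forall>f Lsf. Ls f Lsf \<longrightarrow>
        (AE \<omega> in M. \<forall>t. 0 < t \<and> ereal t < min (ereal T) (\<tau> \<omega>) \<longrightarrow>
           set_integrable lborel {0..t}
             (\<lambda>s. (k s)\<^sup>2 / 2 * L2_inner D (v s \<omega>) Lsf - (a s)\<^sup>2 / 2 * L2_inner D (v s \<omega>) f) \<and>
           (AE s\<in>{0..t} in lborel. set_integrable lborel D (\<lambda>x. g (exp (N s \<omega>) * v s \<omega> x) * f x)) \<and>
           set_integrable lborel {0..t}
             (\<lambda>s. exp (- N s \<omega>) * L2_inner D (\<lambda>x. g (exp (N s \<omega>) * v s \<omega> x)) f) \<and>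
           L2_inner D (v t \<omega>) f = L2_inner D \<phi> f
             + (LINT s:{0..t}|lborel.
                  (k s)\<^sup>2 / 2 * L2_inner D (v s \<omega>) Lsf - (a s)\<^sup>2 / 2 * L2_inner D (v s \<omega>) f)
             + (LINT s:{0..t}|lborel.
                  exp (- N s \<omega>) * L2_inner D (\<lambda>x. g (exp (N s \<omega>) * v s \<omega> x)) f)))"

text \<open>Weak solutions up to \<open>\<tau>\<close> of \<open>du = [k\<^sup>2/2 L u + g(u)] dt + u dN\<close>, \<open>u(\<cdot>,0) = \<phi>\<close>. The integral
  against \<open>dN\<close> is the sum of the Ito integral against \<open>a dB\<close> and the generalized
  Riemann--Stieltjes integral against \<open>b dB\<^sup>H\<close>.\<close>

definition weak_solution_spde ::
    "'w measure \<Rightarrow> (real \<Rightarrow> 'w measure) \<Rightarrow> 'a::euclidean_space set \<Rightarrow>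
     (('a \<Rightarrow> real) \<Rightarrow> ('a \<Rightarrow> real) \<Rightarrow> bool) \<Rightarrow> (real \<Rightarrow> real) \<Rightarrow> (real \<Rightarrow> real) \<Rightarrow> (real \<Rightarrow> real) \<Rightarrow>
     (real \<Rightarrow> real) \<Rightarrow> real \<Rightarrow> (real \<Rightarrow> 'w \<Rightarrow> real) \<Rightarrow> (real \<Rightarrow> 'w \<Rightarrow> real) \<Rightarrow> ('a \<Rightarrow> real) \<Rightarrow>
     ('w \<Rightarrow> ereal) \<Rightarrow> (real \<Rightarrow> 'w \<Rightarrow> 'a \<Rightarrow> real) \<Rightarrow> bool" where
  "weak_solution_spde M F D Ls k a b g H B BH \<phi> \<tau> u \<longleftrightarrow> adapted_L2_field M F D \<tau> u \<and>
     (\<forall>T>0. \<forall>f Lsf. Ls f Lsf \<longrightarrow>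
        (\<exists>I. has_ito_integral M F B \<tau> (\<lambda>s \<omega>. a s * L2_inner D (u s \<omega>) f) I \<and>
          (AE \<omega> in M. \<forall>t. 0 < t \<and> ereal t < min (ereal T) (\<tau> \<omega>) \<longrightarrow>
             set_integrable lborel {0..t} (\<lambda>s. (a s)\<^sup>2 * (1 + (L2_inner D (u s \<omega>) f)\<^sup>2)) \<and>
             (\<exists>\<gamma>>1 - H. holder_on \<gamma> {0..t} (\<lambda>s. b s * L2_inner D (u s \<omega>) f)) \<and>
             (AE s\<in>{0..t} in lborel. set_integrable lborel D (\<lambda>x. g (u s \<omega> x) * f x)) \<and>
             set_integrable lborel {0..t} (\<lambda>s. (k s)\<^sup>2 * L2_inner D (u s \<omega>) Lsf) \<and>
             set_integrable lborel {0..t} (\<lambda>s. L2_inner D (\<lambda>x. g (u s \<omega> x)) f) \<and>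
             (\<exists>J. has_frac_integral (\<lambda>s. b s * L2_inner D (u s \<omega>) f) (\<lambda>s. BH s \<omega>) 0 t J \<and>
                L2_inner D (u t \<omega>) f = L2_inner D \<phi> f
                  + (LINT s:{0..t}|lborel. (k s)\<^sup>2 / 2 * L2_inner D (u s \<omega>) Lsf
                                            + L2_inner D (\<lambda>x. g (u s \<omega> x)) f)
                  + (I t \<omega> + J)))))"

text \<open>\<open>c\<^bsup>-\<beta>\<^esup>\<close> for \<open>c \<ge> 0\<close> with \<open>0\<^bsup>-\<beta>\<^esup> = \<infinity>\<close>, whereas \<open>0 powr (- \<beta>) = 0\<close>.\<close>

definition neg_power :: "real \<Rightarrow> real \<Rightarrow> ereal" where
  "neg_power c \<beta> = (if c = 0 then \<infinity> else ereal (c powr (- \<beta>)))"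

end

theory Submission
  imports Defs
begin

text \<open>Testing the equation of \<open>v\<close> against the eigenfunction \<open>\<phi>\<^sub>0\<close> turns it into a scalar problem:
  since \<open>L\<^sup>* \<phi>\<^sub>0 = - \<lambda>\<^sub>0 \<phi>\<^sub>0\<close>, the function \<open>y(t) = \<langle>v(\<cdot>,t), \<phi>\<^sub>0\<rangle>\<close> satisfies, path by path and before \<open>\<tau>\<close>,
  \<open>y' = - q y + G\<close> with \<open>q = \<lambda>\<^sub>0 k\<^sup>2/2 + a\<^sup>2/2\<close> and \<open>G = e\<^bsup>-N\<^esup> \<langle>g(e\<^bsup>N\<^esup> v), \<phi>\<^sub>0\<rangle>\<close>. As \<open>\<phi>\<^sub>0 dx\<close> is a
  probability measure, Jensen's inequality for \<open>z \<mapsto> z\<^bsup>1+\<beta>\<^esup>\<close> gives \<open>G \<ge> C e\<^bsup>\<beta>N\<^esup> y\<^bsup>1+\<beta>\<^esup>\<close> wherever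
  \<open>y > 0\<close> (\<open>superlinear_jensen\<close>).

  With \<open>m(t) = \<integral>\<^sub>0\<^sup>t q = \<lambda>\<^sub>0 K(t) + A(t)\<close>, the function \<open>z = e\<^bsup>m\<^esup> y\<close> formally satisfies
  \<open>z' = e\<^bsup>m\<^esup> G\<close>. First, \<open>G \<ge> 0\<close> yields \<open>z \<ge> y(0)\<close>, so \<open>y\<close> remains positive if \<open>y(0) = \<langle>\<phi>, \<phi>\<^sub>0\<rangle> > 0\<close>.
  Then the Jensen bound becomes \<open>z' \<ge> C h z\<^bsup>1+\<beta>\<^esup>\<close> with \<open>h = e\<^bsup>-\<beta>m+\<beta>N\<^esup>\<close>, the integrand that defines
  \<open>\<tau>\<^sup>*\<close>. Hence \<open>(z\<^bsup>-\<beta>\<^esup>)' \<le> - C \<beta> h\<close>, and as \<open>z\<^bsup>-\<beta>\<^esup>\<close> stays positive,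
  \<open>C \<beta> \<integral>\<^sub>0\<^sup>t h < y(0)\<^bsup>-\<beta>\<^esup>\<close> for every \<open>t < \<tau>\<close> (\<open>weak_supersolution_bound\<close>). So no time that competes in
  the infimum \<open>\<tau>\<^sup>*\<close> lies before \<open>\<tau>\<close>, i.e. \<open>\<tau> \<le> \<tau>\<^sup>*\<close>. If \<open>y(0) = 0\<close>, then no time competes and
  \<open>\<tau>\<^sup>* = \<infinity>\<close>. Finally, \<open>u\<close> blows up at \<open>\<tau> < \<infinity>\<close> by definition, and so does \<open>v = e\<^bsup>-N\<^esup> u\<close>, as \<open>N\<close> is
  bounded on \<open>[0, \<tau>]\<close>.

  The function \<open>q\<close> is only integrable, so \<open>m\<close> and \<open>z\<close> are merely absolutely continuous and the
  product rule behind \<open>z' = e\<^bsup>m\<^esup> G\<close> is not classical. \<open>integrating_factor\<close> proves the inequality it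
  implies by comparing increments over short intervals. After this step all integrands are
  continuous, and the classical fundamental theorem of calculus suffices.\<close>

section \<open>Linear differential inequalities with integrable coefficients\<close>

text \<open>A derivative-free criterion for monotonicity: summing up the increments over a fine partition
  leaves an error \<open>e (\<mu> T - \<mu> 0)\<close>, and \<open>e\<close> is arbitrary. The errors are measured by \<open>\<mu>\<close> rather than
  by the length of the interval because the coefficients below are not bounded.\<close>

lemma le_of_small_increments:
  fixes f \<mu> :: "real \<Rightarrow> real"
  assumes T: "0 \<le> T"
    and incr: "\<And>e. e > 0 \<Longrightarrow>
      \<exists>d>0. \<forall>s t. 0 \<le> s \<and> s \<le> t \<and> t \<le> T \<and> t - s < d \<longrightarrow> f s - f t \<le> e * (\<mu> t - \<mu> s)"
  shows "f 0 \<le> f T"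
proof (rule ccontr)
  assume "\<not> f 0 \<le> f T"
  define e where "e = (f 0 - f T) / (2 * (\<bar>\<mu> T - \<mu> 0\<bar> + 1))"
  have e: "e > 0"
    unfolding e_def using \<open>\<not> f 0 \<le> f T\<close> by (intro divide_pos_pos mult_pos_pos add_nonneg_pos) auto
  obtain d where d: "d > 0"
    "\<And>s t. 0 \<le> s \<Longrightarrow> s \<le> t \<Longrightarrow> t \<le> T \<Longrightarrow> t - s < d \<Longrightarrow> f s - f t \<le> e * (\<mu> t - \<mu> s)"
    using incr[OF e] by auto
  have "0 \<le> (0::real) \<longrightarrow> T \<le> T \<longrightarrow> f 0 - f T \<le> e * (\<mu> T - \<mu> 0)"
    using T
  proof (rule Bolzano[where P = "\<lambda>s t. 0 \<le> s \<longrightarrow> t \<le> T \<longrightarrow> f s - f t \<le> e * (\<mu> t - \<mu> s)"])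
    show "0 \<le> s \<longrightarrow> t \<le> T \<longrightarrow> f s - f t \<le> e * (\<mu> t - \<mu> s)"
      if "0 \<le> s \<longrightarrow> r \<le> T \<longrightarrow> f s - f r \<le> e * (\<mu> r - \<mu> s)"
        "0 \<le> r \<longrightarrow> t \<le> T \<longrightarrow> f r - f t \<le> e * (\<mu> t - \<mu> r)" "s \<le> r" "r \<le> t" for s r t
      using that by (auto simp: algebra_simps)
    show "\<exists>d>0. \<forall>s t. s \<le> r \<and> r \<le> t \<and> t - s < d \<longrightarrow>
        0 \<le> s \<longrightarrow> t \<le> T \<longrightarrow> f s - f t \<le> e * (\<mu> t - \<mu> s)" for r
      using d by (intro exI[of _ d]) auto
  qed
  then have "f 0 - f T \<le> e * (\<mu> T - \<mu> 0)" by simp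
  also have "\<dots> \<le> e * (\<bar>\<mu> T - \<mu> 0\<bar> + 1)"
    using e by (intro mult_left_mono) auto
  also have "\<dots> = (f 0 - f T) / 2"
    unfolding e_def by (simp add: field_simps add_nonneg_eq_0_iff)
  finally show False using \<open>\<not> f 0 \<le> f T\<close> by simp
qed

lemma integral_Icc_diff:
  fixes f :: "real \<Rightarrow> real"
  assumes f: "f integrable_on {a..b}" and st: "a \<le> s" "s \<le> t" "t \<le> b"
  shows "integral {a..t} f - integral {a..s} f = integral {s..t} f"
proof -
  have "f integrable_on {a..t}"
    by (rule integrable_on_subinterval[OF f]) (use st in auto)
  from Henstock_Kurzweil_Integration.integral_combine[OF st(1,2) this] show ?thesis by simp
qed

text \<open>The product rule for \<open>e\<^bsup>m\<^esup> Y\<close> in the form of an inequality. The hypothesis \<open>incr\<close> says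
  \<open>Y' \<ge> c - q Y\<close> in integrated form. On a short interval \<open>{s..t}\<close> with \<open>Q = m t - m s\<close>, the increment
  of \<open>e\<^bsup>m\<^esup> Y\<close> is \<open>e\<^bsup>m t\<^esup> (Y t - Y s) + Y s (e\<^bsup>m t\<^esup> - e\<^bsup>m s\<^esup>)\<close>. Here \<open>e\<^bsup>m t\<^esup> \<integral> q Y \<approx> e\<^bsup>m t\<^esup> Y s Q\<close> and
  \<open>e\<^bsup>m t\<^esup> - e\<^bsup>m s\<^esup> \<approx> e\<^bsup>m t\<^esup> Q\<close>, both up to a small multiple of \<open>Q\<close> by uniform continuity of \<open>Y\<close> and
  \<open>e\<^bsup>m\<^esup>\<close>, so these contributions cancel. What remains is at least \<open>\<integral> e\<^bsup>m\<^esup> c\<close>, since \<open>m\<close> is increasing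
  and \<open>c \<ge> 0\<close>.\<close>

lemma integrating_factor:
  fixes q Y c :: "real \<Rightarrow> real" and T :: real
  defines "m \<equiv> \<lambda>t. integral {0..t} q"
  assumes T: "0 \<le> T"
    and q: "q integrable_on {0..T}" "\<And>s. s \<in> {0..T} \<Longrightarrow> 0 \<le> q s"
    and Y: "continuous_on {0..T} Y"
    and qY: "(\<lambda>s. q s * Y s) integrable_on {0..T}"
    and c: "continuous_on {0..T} c" "\<And>s. s \<in> {0..T} \<Longrightarrow> 0 \<le> c s"
    and incr: "\<And>s t. 0 \<le> s \<Longrightarrow> s \<le> t \<Longrightarrow> t \<le> T \<Longrightarrow>
      integral {s..t} c - integral {s..t} (\<lambda>r. q r * Y r) \<le> Y t - Y s"
  shows "Y 0 + integral {0..T} (\<lambda>s. exp (m s) * c s) \<le> exp (m T) * Y T"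
proof -
  have m_cont: "continuous_on {0..T} m"
    unfolding m_def using q(1) by (rule indefinite_integral_continuous_1)
  have m_diff: "integral {s..t} q = m t - m s" if "0 \<le> s" "s \<le> t" "t \<le> T" for s t
    using integral_Icc_diff[OF q(1) that] by (simp add: m_def)
  have m_mono: "m s \<le> m t" if "0 \<le> s" "s \<le> t" "t \<le> T" for s t
  proof -
    have "0 \<le> integral {s..t} q"
      by (rule integral_nonneg) (use that q in \<open>auto intro: integrable_on_subinterval\<close>)
    then show ?thesis using m_diff[OF that] by simp
  qed
  have ec: "continuous_on {0..T} (\<lambda>s. exp (m s) * c s)"
    by (intro continuous_intros m_cont c)
  define f where "f = (\<lambda>t. exp (m t) * Y t - integral {0..t} (\<lambda>s. exp (m s) * c s))"
  obtain K where K: "K > 0" "\<And>s. s \<in> {0..T} \<Longrightarrow> \<bar>Y s\<bar> \<le> K"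
    using compact_imp_bounded[OF compact_continuous_image[OF Y compact_Icc]]
    by (auto simp: bounded_pos)
  have "f 0 \<le> f T"
  proof (rule le_of_small_increments[where \<mu> = "\<lambda>t. (K + exp (m T)) * m t", OF T])
    fix e :: real assume e: "e > 0"
    obtain d1 where d1: "d1 > 0"
      "\<And>r s. r \<in> {0..T} \<Longrightarrow> s \<in> {0..T} \<Longrightarrow> dist s r < d1 \<Longrightarrow> dist (Y s) (Y r) < e"
      using compact_uniformly_continuous[OF Y compact_Icc] e
      unfolding uniformly_continuous_on_def by meson
    have m_exp: "continuous_on {0..T} (\<lambda>t. exp (m t))"
      by (intro continuous_intros m_cont)
    obtain d2 where d2: "d2 > 0"
      "\<And>r s. r \<in> {0..T} \<Longrightarrow> s \<in> {0..T} \<Longrightarrow> dist s r < d2 \<Longrightarrow> dist (exp (m s)) (exp (m r)) < e"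
      using compact_uniformly_continuous[OF m_exp compact_Icc] e
      unfolding uniformly_continuous_on_def by meson
    show "\<exists>d>0. \<forall>s t. 0 \<le> s \<and> s \<le> t \<and> t \<le> T \<and> t - s < d \<longrightarrow>
        f s - f t \<le> e * ((K + exp (m T)) * m t - (K + exp (m T)) * m s)"
    proof (intro exI[of _ "min d1 d2"] conjI allI impI)
      show "0 < min d1 d2" using d1 d2 by simp
      fix s t assume st: "0 \<le> s \<and> s \<le> t \<and> t \<le> T \<and> t - s < min d1 d2"
      define Q where "Q = m t - m s"
      have Q: "0 \<le> Q" "integral {s..t} q = Q"
        using m_mono m_diff st by (auto simp: Q_def)
      have sub: "{s..t} \<subseteq> {0..T}" using st by auto
      have int_q: "q integrable_on {s..t}" and int_qY: "(\<lambda>r. q r * Y r) integrable_on {s..t}"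
        using q(1) qY sub by (auto intro: integrable_on_subinterval)
      have int_c: "c integrable_on {s..t}" and int_ec: "(\<lambda>r. exp (m r) * c r) integrable_on {s..t}"
        using c(1) ec sub by (auto intro!: integrable_continuous_real intro: continuous_on_subset)
      have "integral {s..t} (\<lambda>r. q r * Y r) \<le> integral {s..t} (\<lambda>r. q r * (Y s + e))"
      proof (rule integral_le[OF int_qY])
        show "(\<lambda>r. q r * (Y s + e)) integrable_on {s..t}"
          using int_q by (rule integrable_on_mult_left)
        fix r assume "r \<in> {s..t}"
        then have "dist (Y r) (Y s) < e" "0 \<le> q r"
          using st q(2) by (auto intro!: d1(2)[unfolded dist_real_def] simp: dist_real_def)
        then show "q r * Y r \<le> q r * (Y s + e)"
          by (intro mult_left_mono) (auto simp: dist_real_def)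
      qed
      also have "\<dots> = Q * (Y s + e)" using Q by simp
      finally have 1: "integral {s..t} (\<lambda>r. q r * Y r) \<le> Q * (Y s + e)" .
      have "integral {s..t} (\<lambda>r. exp (m r) * c r) \<le> integral {s..t} (\<lambda>r. exp (m t) * c r)"
        using sub st m_mono c(2)
        by (intro integral_le int_ec integrable_on_mult_right int_c mult_right_mono) auto
      also have "\<dots> = exp (m t) * integral {s..t} c" by simp
      finally have 2: "integral {s..t} (\<lambda>r. exp (m r) * c r) \<le> exp (m t) * integral {s..t} c" .
      have "exp (m t) * (integral {s..t} c - Q * (Y s + e)) \<le> exp (m t) * (Y t - Y s)"
        using incr[of s t] st 1 by (intro mult_left_mono) auto
      then have 3: "integral {s..t} (\<lambda>r. exp (m r) * c r) - exp (m t) * Q * (Y s + e)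
          \<le> exp (m t) * (Y t - Y s)"
        using 2 by (simp add: algebra_simps)
      have E: "dist (exp (m t)) (exp (m s)) < e"
        using st by (intro d2(2)) (auto simp: dist_real_def)
      \<comment> \<open>By convexity of \<open>exp\<close>, its increment lies between the two tangent values \<open>exp (m s) * Q\<close> and
        \<open>exp (m t) * Q\<close>, which differ by at most \<open>e * Q\<close>.\<close>
      have "1 - Q \<le> exp (- Q)" "1 + Q \<le> exp Q"
        using exp_ge_add_one_self[of "-Q"] exp_ge_add_one_self[of Q] by auto
      then have "exp (m t) * (1 - Q) \<le> exp (m t) * exp (- Q)" "exp (m s) * (1 + Q) \<le> exp (m s) * exp Q"
        by (auto intro: mult_left_mono)
      moreover have "exp (m t) * exp (- Q) = exp (m s)" "exp (m s) * exp Q = exp (m t)"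
        by (simp_all add: Q_def flip: exp_add)
      ultimately have low: "exp (m s) * Q \<le> exp (m t) - exp (m s)"
        and upp: "exp (m t) - exp (m s) \<le> exp (m t) * Q"
        by (auto simp: algebra_simps)
      have "0 \<le> exp (m t) * Q - (exp (m t) - exp (m s))" using upp by simp
      moreover have "exp (m t) * Q - (exp (m t) - exp (m s)) \<le> (exp (m t) - exp (m s)) * Q"
        using low by (simp add: algebra_simps)
      moreover have "(exp (m t) - exp (m s)) * Q \<le> e * Q"
        using E Q by (intro mult_right_mono) (auto simp: dist_real_def)
      ultimately have 4: "\<bar>exp (m t) * Q - (exp (m t) - exp (m s))\<bar> \<le> e * Q" by linarith
      have "\<bar>Y s * (exp (m t) * Q - (exp (m t) - exp (m s)))\<bar> \<le> K * (e * Q)"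
        unfolding abs_mult using st by (intro mult_mono 4 K(2)) (use K(1) in auto)
      then have 5: "Y s * (exp (m t) * Q - (exp (m t) - exp (m s))) \<le> K * (e * Q)" by linarith
      have 6: "exp (m t) * (e * Q) \<le> exp (m T) * (e * Q)"
        using st m_mono e Q by (intro mult_right_mono) auto
      have "integral {0..t} (\<lambda>s. exp (m s) * c s) - integral {0..s} (\<lambda>s. exp (m s) * c s)
          = integral {s..t} (\<lambda>s. exp (m s) * c s)"
        using st by (intro integral_Icc_diff[OF integrable_continuous_real[OF ec]]) auto
      then have "f s - f t = integral {s..t} (\<lambda>r. exp (m r) * c r)
          - exp (m t) * (Y t - Y s) - Y s * (exp (m t) - exp (m s))"
        by (simp add: f_def algebra_simps)
      also have "\<dots> \<le> e * ((K + exp (m T)) * Q)"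
        using 3 5 6 by (simp add: algebra_simps)
      finally show "f s - f t \<le> e * ((K + exp (m T)) * m t - (K + exp (m T)) * m s)"
        by (simp add: Q_def algebra_simps)
    qed
  qed
  then show ?thesis by (simp add: f_def m_def)
qed

section \<open>Superlinear growth\<close>

text \<open>The lower bound \<open>R t = z0 + \<integral>\<^sub>0\<^sup>t h z\<^bsup>1+\<beta>\<^esup>\<close> of \<open>z\<close> is continuously differentiable, which \<open>z\<close> need
  not be, and inherits the inequality: \<open>R' = h z\<^bsup>1+\<beta>\<^esup> \<ge> h R\<^bsup>1+\<beta>\<^esup>\<close>. Therefore \<open>R\<^bsup>-\<beta>\<^esup> + \<beta> \<integral> h\<close> decreases,
  and \<open>R\<^bsup>-\<beta>\<^esup>\<close> is positive as long as \<open>R\<close> is finite.\<close>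

lemma superlinear_comparison:
  fixes h z :: "real \<Rightarrow> real"
  assumes T: "0 \<le> T" and \<beta>: "\<beta> > 0" and z0: "z0 > 0"
    and h: "continuous_on {0..T} h" "\<And>s. s \<in> {0..T} \<Longrightarrow> 0 \<le> h s"
    and z: "continuous_on {0..T} z" "\<And>s. s \<in> {0..T} \<Longrightarrow> 0 < z s"
    and ineq: "\<And>t. t \<in> {0..T} \<Longrightarrow> z0 + integral {0..t} (\<lambda>s. h s * z s powr (1 + \<beta>)) \<le> z t"
  shows "\<beta> * integral {0..T} h < z0 powr (- \<beta>)"
proof -
  define w where "w = (\<lambda>s. h s * z s powr (1 + \<beta>))"
  define R where "R = (\<lambda>t. z0 + integral {0..t} w)"
  define V where "V = (\<lambda>t. R t powr (- \<beta>) + \<beta> * integral {0..t} h)"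
  have w: "continuous_on {0..T} w"
    unfolding w_def using \<beta> by (intro continuous_intros continuous_on_powr h z) (use z(2) in force)
  have R_ge: "z0 \<le> R t" if "t \<in> {0..T}" for t
  proof -
    have "0 \<le> integral {0..t} w"
      using that h(2) w
      by (intro integral_nonneg integrable_continuous_real)
        (auto simp: w_def intro: continuous_on_subset)
    then show ?thesis by (simp add: R_def)
  qed
  have Rz: "R t \<le> z t" if "t \<in> {0..T}" for t
    using ineq[OF that] by (simp add: R_def w_def)
  have contR: "continuous_on {0..T} R"
    unfolding R_def
    by (intro continuous_intros indefinite_integral_continuous_1 integrable_continuous_real w)
  have "V T \<le> V 0"
  proof (rule DERIV_nonpos_imp_decreasing_open[OF T])
    show "continuous_on {0..T} V"
      unfolding V_def
      by (intro continuous_intros continuous_on_powr contR indefinite_integral_continuous_1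
          integrable_continuous_real h(1))
        (use R_ge z0 in force)
    fix t assume t: "0 < t" "t < T"
    then have tT: "t \<in> {0..T}" by auto
    have at: "at t within {0..T} = at t" using t by (rule at_within_Icc_at)
    have pos: "0 < R t" using R_ge[OF tT] z0 by simp
    have "(R has_real_derivative w t) (at t)"
      unfolding R_def using integral_has_real_derivative[OF w tT, unfolded at]
      by (auto intro!: derivative_eq_intros)
    moreover have "((\<lambda>t. integral {0..t} h) has_real_derivative h t) (at t)"
      using integral_has_real_derivative[OF h(1) tT, unfolded at] .
    ultimately have "(V has_real_derivative (- \<beta>) * R t powr (- \<beta> - 1) * w t + \<beta> * h t) (at t)"
      unfolding V_def using pos
      by (auto intro!: derivative_eq_intros simp: powr_diff field_simps)
    moreover have "(- \<beta>) * R t powr (- \<beta> - 1) * w t + \<beta> * h t \<le> 0"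
    proof -
      have "1 = R t powr (- \<beta> - 1) * R t powr (1 + \<beta>)"
        using pos by (simp flip: powr_add)
      also have "\<dots> \<le> R t powr (- \<beta> - 1) * z t powr (1 + \<beta>)"
        using Rz[OF tT] pos \<beta> by (intro mult_left_mono powr_mono2) auto
      finally have "\<beta> * h t * 1 \<le> \<beta> * h t * (R t powr (- \<beta> - 1) * z t powr (1 + \<beta>))"
        using \<beta> h(2)[OF tT] by (intro mult_left_mono) auto
      then show ?thesis by (simp add: w_def mult_ac)
    qed
    ultimately show "\<exists>d. (V has_real_derivative d) (at t) \<and> d \<le> 0" by blast
  qed
  moreover have "0 < R T powr (- \<beta>)"
    using R_ge[of T] z0 T by simp
  moreover have "V 0 = z0 powr (- \<beta>)" by (simp add: V_def R_def)
  ultimately show ?thesis unfolding V_def by linarith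
qed

text \<open>The scalar blowup criterion. The equation is required at positive times only, so \<open>y 0\<close> is
  arbitrary; \<open>Y\<close> is the continuous version of \<open>y\<close> with \<open>Y 0 = y0\<close>. The integrating factor is used
  twice: with \<open>c = 0\<close> it gives the positivity of \<open>Y\<close>, which makes the superlinear lower bound of
  \<open>G\<close> available; with this bound as \<open>c\<close> it then reduces the claim to \<open>superlinear_comparison\<close>
  for \<open>z = e\<^bsup>m\<^esup> Y\<close>.\<close>

lemma weak_supersolution_bound:
  fixes y q G N :: "real \<Rightarrow> real"
  defines "m \<equiv> \<lambda>t. integral {0..t} q"
  assumes T: "0 < T" and C: "C > 0" and \<beta>: "\<beta> > 0" and y0: "y0 > 0"
    and q: "set_integrable lborel {0..T} q" "\<And>s. 0 \<le> q s"
    and N: "continuous_on {0..T} N"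
    and qy: "set_integrable lborel {0..T} (\<lambda>s. q s * y s)"
    and G: "set_integrable lborel {0..T} G" "\<And>s. s \<in> {0..T} \<Longrightarrow> 0 \<le> G s"
      "AE s\<in>{0..T} in lborel. 0 < y s \<longrightarrow> C * exp (\<beta> * N s) * y s powr (1 + \<beta>) \<le> G s"
    and eq: "\<And>t. 0 < t \<Longrightarrow> t \<le> T \<Longrightarrow>
      y t = y0 - (LINT s:{0..t}|lborel. q s * y s) + (LINT s:{0..t}|lborel. G s)"
  shows "C * \<beta> * integral {0..T} (\<lambda>s. exp (- \<beta> * m s + \<beta> * N s)) < y0 powr (- \<beta>)"
proof -
  have qi: "q integrable_on {0..T}" and qyi: "(\<lambda>s. q s * y s) integrable_on {0..T}"
    and Gi: "G integrable_on {0..T}"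
    using q qy G by (auto intro: set_borel_integral_eq_integral)
  define Y where "Y = (\<lambda>t. y0 - integral {0..t} (\<lambda>s. q s * y s) + integral {0..t} G)"
  have Y_eq: "y t = Y t" if "0 < t" "t \<le> T" for t
  proof -
    have "{0..t} \<subseteq> {0..T}" using that by auto
    then have "set_integrable lborel {0..t} (\<lambda>s. q s * y s)" "set_integrable lborel {0..t} G"
      using qy G(1) by (auto intro: set_integrable_subset)
    then show ?thesis
      using eq[OF that] by (simp add: Y_def set_borel_integral_eq_integral(2))
  qed
  have Y0: "Y 0 = y0" by (simp add: Y_def)
  have Y: "continuous_on {0..T} Y"
    unfolding Y_def by (intro continuous_intros indefinite_integral_continuous_1 qyi Gi)
  have m: "continuous_on {0..T} m"
    unfolding m_def by (intro indefinite_integral_continuous_1 qi)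
  have qYi: "(\<lambda>s. q s * Y s) integrable_on {0..T}"
    by (rule integrable_spike[OF qyi negligible_sing[of 0]]) (use Y_eq in auto)
  have factor: "y0 + integral {0..t} (\<lambda>s. exp (m s) * c s) \<le> exp (m t) * Y t"
    if t: "t \<in> {0..T}" and c: "continuous_on {0..T} c" "\<And>s. s \<in> {0..T} \<Longrightarrow> 0 \<le> c s"
      "AE s\<in>{0..T} in lborel. c s \<le> G s" for t c
    unfolding Y0[symmetric] m_def
  proof (rule integrating_factor)
    show "q integrable_on {0..t}" "(\<lambda>s. q s * Y s) integrable_on {0..t}"
      using qi qYi t by (auto intro: integrable_on_subinterval)
    show "continuous_on {0..t} Y" "continuous_on {0..t} c"
      using Y c(1) t by (auto intro: continuous_on_subset)
    fix r s assume rs: "0 \<le> r" "r \<le> s" "s \<le> t"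
    then have sub: "{r..s} \<subseteq> {0..T}" using t by auto
    have split: "integral {0..s} f - integral {0..r} f = integral {r..s} f"
      if "f integrable_on {0..T}" for f :: "real \<Rightarrow> real"
      using integral_Icc_diff[OF that, of r s] rs t by auto
    have "integral {r..s} (\<lambda>x. q x * y x) = integral {r..s} (\<lambda>x. q x * Y x)"
      by (rule integral_spike[OF negligible_sing[of 0]]) (use Y_eq sub in auto)
    then have Yd: "Y s - Y r = integral {r..s} G - integral {r..s} (\<lambda>x. q x * Y x)"
      using split[OF qyi] split[OF Gi] by (simp add: Y_def)
    have ci: "set_integrable lborel {r..s} c"
      by (rule borel_integrable_atLeastAtMost') (use c(1) sub in \<open>auto intro: continuous_on_subset\<close>)
    have Gi': "set_integrable lborel {r..s} G"
      using G(1) sub by (auto intro: set_integrable_subset)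
    have "AE x\<in>{r..s} in lborel. c x \<le> G x"
      using c(3) sub by auto
    then have "(LINT x:{r..s}|lborel. c x) \<le> (LINT x:{r..s}|lborel. G x)"
      by (rule set_integral_mono_AE[OF ci Gi'])
    then have "integral {r..s} c \<le> integral {r..s} G"
      using ci Gi' by (simp add: set_borel_integral_eq_integral(2))
    then show "integral {r..s} c - integral {r..s} (\<lambda>x. q x * Y x) \<le> Y s - Y r"
      using Yd by simp
  qed (use t q c in auto)
  have z_pos: "y0 \<le> exp (m t) * Y t" if "t \<in> {0..T}" for t
    using factor[of t "\<lambda>_. 0"] that G(2) by auto
  then have z_pos': "0 < exp (m t) * Y t" if "t \<in> {0..T}" for t
    using that y0 by force
  then have Y_pos: "0 < Y t" if "t \<in> {0..T}" for t
    using that by (simp add: zero_less_mult_iff)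
  define c where "c = (\<lambda>s. C * exp (\<beta> * N s) * Y s powr (1 + \<beta>))"
  have c_cont: "continuous_on {0..T} c"
    unfolding c_def by (intro continuous_intros continuous_on_powr N Y) (use Y_pos in force)
  have cG: "AE s\<in>{0..T} in lborel. c s \<le> G s"
    using G(3) AE_lborel_singleton[of 0]
    by eventually_elim (use Y_eq Y_pos in \<open>force simp: c_def\<close>)
  define h where "h = (\<lambda>s. C * exp (- \<beta> * m s + \<beta> * N s))"
  have hz: "exp (m s) * c s = h s * (exp (m s) * Y s) powr (1 + \<beta>)" if "s \<in> {0..T}" for s
  proof -
    have "(exp (m s) * Y s) powr (1 + \<beta>) = exp (m s + \<beta> * m s) * Y s powr (1 + \<beta>)"
      using Y_pos[OF that] by (simp add: powr_mult exp_powr_real algebra_simps)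
    moreover have "exp (m s) * exp (\<beta> * N s) = exp (- \<beta> * m s + \<beta> * N s) * exp (m s + \<beta> * m s)"
      by (simp flip: exp_add)
    ultimately show ?thesis by (simp add: c_def h_def)
  qed
  have "\<beta> * integral {0..T} h < y0 powr (- \<beta>)"
  proof (rule superlinear_comparison[where z = "\<lambda>t. exp (m t) * Y t"])
    show "continuous_on {0..T} h" "continuous_on {0..T} (\<lambda>t. exp (m t) * Y t)"
      unfolding h_def by (intro continuous_intros m N Y)+
    fix t assume t: "t \<in> {0..T}"
    have "integral {0..t} (\<lambda>s. h s * (exp (m s) * Y s) powr (1 + \<beta>))
        = integral {0..t} (\<lambda>s. exp (m s) * c s)"
      by (rule integral_cong) (use hz t in auto)
    then show "y0 + integral {0..t} (\<lambda>s. h s * (exp (m s) * Y s) powr (1 + \<beta>)) \<le> exp (m t) * Y t"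
      using factor[OF t c_cont _ cG] C by (simp add: c_def)
  qed (use T \<beta> y0 C z_pos' in \<open>auto simp: h_def\<close>)
  then show ?thesis by (simp add: h_def mult_ac)
qed

section \<open>Testing against an eigenfunction\<close>

lemma L2_mult_integrable:
  fixes f h :: "'a::euclidean_space \<Rightarrow> real"
  assumes "f \<in> L2 D" "h \<in> L2 D"
  shows "set_integrable lborel D (\<lambda>x. f x * h x)"
proof -
  let ?I = "indicator D :: 'a \<Rightarrow> real"
  have m: "(\<lambda>x. ?I x * f x) \<in> borel_measurable lborel" "(\<lambda>x. ?I x * h x) \<in> borel_measurable lborel"
    using assms by (auto simp: L2_def set_borel_measurable_def)
  have eq: "?I x *\<^sub>R (f x * h x) = (?I x * f x) * (?I x * h x)" for x
    by (auto split: split_indicator)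
  have int: "integrable lborel (\<lambda>x. ?I x *\<^sub>R (f x)\<^sup>2 + ?I x *\<^sub>R (h x)\<^sup>2)"
    using assms by (intro Bochner_Integration.integrable_add) (auto simp: L2_def set_integrable_def)
  have young: "\<bar>r * s\<bar> \<le> r\<^sup>2 + s\<^sup>2" for r s :: real
  proof -
    have "2 * (\<bar>r\<bar> * \<bar>s\<bar>) \<le> r\<^sup>2 + s\<^sup>2" "0 \<le> \<bar>r\<bar> * \<bar>s\<bar>"
      using zero_le_power2[of "\<bar>r\<bar> - \<bar>s\<bar>"] by (simp_all add: power2_diff)
    then show ?thesis unfolding abs_mult by linarith
  qed
  show ?thesis
    unfolding set_integrable_def
  proof (rule Bochner_Integration.integrable_bound[OF int])
    show "(\<lambda>x. ?I x *\<^sub>R (f x * h x)) \<in> borel_measurable lborel"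
      unfolding eq using m by (rule borel_measurable_times)
    show "AE x in lborel. norm (?I x *\<^sub>R (f x * h x)) \<le> norm (?I x *\<^sub>R (f x)\<^sup>2 + ?I x *\<^sub>R (h x)\<^sup>2)"
      by (auto split: split_indicator intro: young)
  qed
qed

lemma powr_above_tangent:
  assumes "0 < c" "0 < (x::real)" "0 < \<beta>"
  shows "c powr (1 + \<beta>) + (1 + \<beta>) * c powr \<beta> * (x - c) \<le> x powr (1 + \<beta>)"
proof -
  have "((\<lambda>x. x powr (1 + \<beta>)) has_real_derivative (1 + \<beta>) * c powr \<beta>) (at c within {0<..})"
    using assms by (auto intro!: derivative_eq_intros)
  then have "x powr (1 + \<beta>) - c powr (1 + \<beta>) \<ge> (1 + \<beta>) * c powr \<beta> * (x - c)"
    using assms by (intro convex_on_imp_above_tangent[OF powr_convex]) (auto simp: interior_open)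
  then show ?thesis by simp
qed

text \<open>Jensen's inequality for the probability density \<open>\<rho>\<close>. Integrating the tangent of \<open>z\<^bsup>1+\<beta>\<^esup>\<close> at the
  mean \<open>c\<close> of \<open>f\<close> covers a function \<open>f\<close> of either sign: where \<open>f \<le> 0\<close> the tangent is negative, and
  \<open>g \<ge> 0\<close> suffices.\<close>

lemma superlinear_jensen:
  fixes f \<rho> :: "'a::euclidean_space \<Rightarrow> real"
  assumes C: "C > 0" and \<beta>: "\<beta> > 0"
    and g: "\<And>z. 0 \<le> g z" "\<And>z. 0 < z \<Longrightarrow> C * z powr (1 + \<beta>) \<le> g z"
    and \<rho>: "set_integrable lborel D \<rho>" "(LINT x:D|lborel. \<rho> x) = 1" "\<And>x. x \<in> D \<Longrightarrow> 0 \<le> \<rho> x"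
    and f: "set_integrable lborel D (\<lambda>x. f x * \<rho> x)"
    and gf: "set_integrable lborel D (\<lambda>x. g (exp n * f x) * \<rho> x)"
    and pos: "0 < L2_inner D f \<rho>"
  shows "C * exp (\<beta> * n) * L2_inner D f \<rho> powr (1 + \<beta>)
    \<le> exp (- n) * L2_inner D (\<lambda>x. g (exp n * f x)) \<rho>"
proof -
  define c where "c = L2_inner D f \<rho>"
  define A where "A = C * exp (n + \<beta> * n)"
  define B where "B = (1 + \<beta>) * c powr \<beta>"
  have c: "0 < c" using pos by (simp add: c_def)
  have A: "0 < A" using C by (simp add: A_def)
  have tangent: "A * (c powr (1 + \<beta>) + B * (z - c)) \<le> g (exp n * z)" for z
  proof (cases "0 < z")
    case True
    have "A * (c powr (1 + \<beta>) + B * (z - c)) \<le> A * z powr (1 + \<beta>)"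
      using powr_above_tangent[OF c True \<beta>] A by (auto simp: B_def intro!: mult_left_mono)
    also have "\<dots> = C * (exp n * z) powr (1 + \<beta>)"
      using True by (simp add: A_def powr_mult exp_powr_real algebra_simps)
    also have "\<dots> \<le> g (exp n * z)"
      using True by (intro g) simp
    finally show ?thesis .
  next
    case False
    have "c powr (1 + \<beta>) = c powr \<beta> * c"
      using c by (simp add: powr_add)
    then have "c powr (1 + \<beta>) + B * (z - c) = c powr \<beta> * ((1 + \<beta>) * z - \<beta> * c)"
      by (simp add: B_def algebra_simps)
    also have "\<dots> \<le> 0"
      using False c \<beta> by (intro mult_nonneg_nonpos) (auto simp: mult_nonneg_nonpos add_nonneg_nonneg
        intro: order_trans[of _ 0])
    finally show ?thesis
      using A g(1) by (meson mult_nonneg_nonpos order_less_imp_le order_trans)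
  qed
  have int: "set_integrable lborel D (\<lambda>x. A * (c powr (1 + \<beta>) - B * c) * \<rho> x + A * B * (f x * \<rho> x))"
    using f \<rho> by (intro set_integral_add set_integrable_mult_right) auto
  have "A * c powr (1 + \<beta>) = (LINT x:D|lborel. A * (c powr (1 + \<beta>) - B * c) * \<rho> x + A * B * (f x * \<rho> x))"
    using f \<rho> by (simp add: set_integral_add c_def L2_inner_def algebra_simps)
  also have "\<dots> \<le> (LINT x:D|lborel. g (exp n * f x) * \<rho> x)"
  proof (rule set_integral_mono[OF int gf])
    fix x assume "x \<in> D"
    then have "A * (c powr (1 + \<beta>) + B * (f x - c)) * \<rho> x \<le> g (exp n * f x) * \<rho> x"
      by (intro mult_right_mono tangent \<rho>)
    then show "A * (c powr (1 + \<beta>) - B * c) * \<rho> x + A * B * (f x * \<rho> x) \<le> g (exp n * f x) * \<rho> x"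
      by (simp add: algebra_simps)
  qed
  finally have "exp (- n) * (A * c powr (1 + \<beta>)) \<le> exp (- n) * L2_inner D (\<lambda>x. g (exp n * f x)) \<rho>"
    by (simp add: L2_inner_def)
  moreover have "exp (- n) * A = C * exp (\<beta> * n)"
    by (simp add: A_def mult.left_commute flip: exp_add)
  ultimately show ?thesis by (simp add: c_def mult.assoc[symmetric])
qed

text \<open>On an eigenfunction the difference quotients of the semigroup are multiples of \<open>f\<close>, and the
  scalar factor converges to the derivative of \<open>exp (- l * t)\<close> at 0.\<close>

lemma generator_eigenfunction:
  fixes f :: "'a::euclidean_space \<Rightarrow> real"
  assumes S: "contraction_semigroup D S" and f: "f \<in> L2 D"
    and eigen: "\<forall>t\<ge>0. eq_ae D (S t f) (\<lambda>x. exp (- l * t) * f x)"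
  shows "generator D S f (\<lambda>x. - l * f x)"
proof -
  have meas: "h \<in> L2 D \<Longrightarrow> (\<lambda>x. indicator D x * h x) \<in> borel_measurable lborel" for h :: "'a \<Rightarrow> real"
    by (simp add: L2_def set_borel_measurable_def)
  have lf: "(\<lambda>x. - l * f x) \<in> L2 D"
  proof -
    have "(\<lambda>x. - l * (indicator D x * f x)) \<in> borel_measurable lborel"
      by (intro borel_measurable_times borel_measurable_const meas f)
    moreover have "set_integrable lborel D (\<lambda>x. l\<^sup>2 * (f x)\<^sup>2)"
      using f by (auto simp: L2_def)
    ultimately show ?thesis
      by (simp add: L2_def set_borel_measurable_def power_mult_distrib mult_ac)
  qed
  have norm_eq: "L2_norm D (\<lambda>x. (S t f x - f x) / t - - l * f x)
      = \<bar>(exp (- l * t) - 1) / t + l\<bar> * L2_norm D f" if t: "t > 0" for t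
  proof -
    define \<kappa> where "\<kappa> = (exp (- l * t) - 1) / t + l"
    have Sf: "S t f \<in> L2 D" using S f t by (auto simp: contraction_semigroup_def)
    have ae: "AE x\<in>D in lborel. S t f x = exp (- l * t) * f x"
      using eigen t by (auto simp: eq_ae_def)
    let ?J = "\<lambda>x. (S t f x - f x) / t - - l * f x"
    have "(LINT x:D|lborel. ?J x * ?J x) = (LINT x:D|lborel. \<kappa>\<^sup>2 * (f x * f x))"
      unfolding set_lebesgue_integral_def
    proof (rule integral_cong_AE)
      have *: "indicator D x *\<^sub>R (?J x * ?J x)
          = ((indicator D x * S t f x - indicator D x * f x) / t + l * (indicator D x * f x))\<^sup>2" for x
        by (auto simp: power2_eq_square split: split_indicator)
      show "(\<lambda>x. indicator D x *\<^sub>R (?J x * ?J x)) \<in> borel_measurable lborel"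
        unfolding * using meas[OF Sf] meas[OF f] by measurable
      have *: "indicator D x *\<^sub>R (\<kappa>\<^sup>2 * (f x * f x)) = \<kappa>\<^sup>2 * (indicator D x * f x)\<^sup>2" for x
        by (auto simp: power2_eq_square split: split_indicator)
      show "(\<lambda>x. indicator D x *\<^sub>R (\<kappa>\<^sup>2 * (f x * f x))) \<in> borel_measurable lborel"
        unfolding * using meas[OF f] by measurable
      show "AE x in lborel. indicator D x *\<^sub>R (?J x * ?J x) = indicator D x *\<^sub>R (\<kappa>\<^sup>2 * (f x * f x))"
        using ae
      proof eventually_elim
        case (elim x)
        have "?J x = \<kappa> * f x" if "x \<in> D"
          using elim that t by (simp add: \<kappa>_def field_simps)
        then show ?case by (auto simp: power2_eq_square mult_ac split: split_indicator)
      qed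
    qed
    then show ?thesis
      unfolding \<kappa>_def[symmetric] by (simp add: L2_norm_def L2_inner_def real_sqrt_mult)
  qed
  have "((\<lambda>t. exp (- l * t)) has_real_derivative - l) (at 0)"
    by (auto intro!: derivative_eq_intros)
  then have "((\<lambda>t. (exp (- l * t) - 1) / t) \<longlongrightarrow> - l) (at 0)"
    by (simp add: DERIV_def)
  then have "((\<lambda>t. (exp (- l * t) - 1) / t) \<longlongrightarrow> - l) (at_right 0)"
    by (rule filterlim_mono) (auto intro: at_le)
  then have "((\<lambda>t. \<bar>(exp (- l * t) - 1) / t + l\<bar> * L2_norm D f) \<longlongrightarrow> \<bar>- l + l\<bar> * L2_norm D f) (at_right 0)"
    by (intro tendsto_intros)
  then have "((\<lambda>t. \<bar>(exp (- l * t) - 1) / t + l\<bar> * L2_norm D f) \<longlongrightarrow> 0) (at_right 0)"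
    by simp
  then have "((\<lambda>t. L2_norm D (\<lambda>x. (S t f x - f x) / t - - l * f x)) \<longlongrightarrow> 0) (at_right 0)"
    by (rule Lim_transform_eventually)
      (use norm_eq in \<open>auto simp: eventually_at_right_less intro!: eventually_mono[OF eventually_at_right_less]\<close>)
  with f lf show ?thesis by (simp add: generator_def)
qed

section \<open>Blowup before the random time\<close>

lemma blows_up_at_rescale:
  assumes T: "0 < T" and N: "continuous_on {0..T} N"
    and wu: "\<And>t x. 0 \<le> t \<Longrightarrow> t < T \<Longrightarrow> x \<in> D \<Longrightarrow> w t x = exp (- N t) * u t x"
    and u: "blows_up_at D u T"
  shows "blows_up_at D w T"
proof -
  obtain K where K: "\<And>t. t \<in> {0..T} \<Longrightarrow> N t \<le> K"
    using compact_imp_bounded[OF compact_continuous_image[OF N compact_Icc]]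
    by (fastforce simp: bounded_real dest: abs_le_D1)
  have "(SUP x\<in>D. ereal \<bar>u t x\<bar>) \<le> ereal (exp K) * (SUP x\<in>D. ereal \<bar>w t x\<bar>)"
    if t: "0 < t" "t < T" for t
  proof (rule SUP_least)
    fix x assume x: "x \<in> D"
    have "\<bar>u t x\<bar> = exp (N t) * \<bar>w t x\<bar>"
      using wu[of t x] t x by (simp add: abs_mult mult.assoc[symmetric] flip: exp_add)
    also have "\<dots> \<le> exp K * \<bar>w t x\<bar>"
      using K[of t] t by (intro mult_right_mono) auto
    finally have "ereal \<bar>u t x\<bar> \<le> ereal (exp K) * ereal \<bar>w t x\<bar>" by simp
    also have "\<dots> \<le> ereal (exp K) * (SUP x\<in>D. ereal \<bar>w t x\<bar>)"
      using x by (intro ereal_mult_left_mono SUP_upper) auto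
    finally show "ereal \<bar>u t x\<bar> \<le> ereal (exp K) * (SUP x\<in>D. ereal \<bar>w t x\<bar>)" .
  qed
  then have "Limsup (at_left T) (\<lambda>t. SUP x\<in>D. ereal \<bar>u t x\<bar>)
      \<le> Limsup (at_left T) (\<lambda>t. ereal (exp K) * (SUP x\<in>D. ereal \<bar>w t x\<bar>))"
    using T by (intro Limsup_mono eventually_at_leftI[of 0]) auto
  also have "\<dots> = ereal (exp K) * Limsup (at_left T) (\<lambda>t. SUP x\<in>D. ereal \<bar>w t x\<bar>)"
    by (rule Limsup_ereal_mult_left) auto
  finally show ?thesis
    using u by (auto simp: blows_up_at_def)
qed

theorem theorem3:
  fixes D :: "(real ^ 'd) set"
    and P Ps :: "real \<Rightarrow> (real ^ 'd \<Rightarrow> real) \<Rightarrow> (real ^ 'd \<Rightarrow> real)"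
    and L Ls :: "(real ^ 'd \<Rightarrow> real) \<Rightarrow> (real ^ 'd \<Rightarrow> real) \<Rightarrow> bool"
    and p :: "real \<Rightarrow> real ^ 'd \<Rightarrow> real ^ 'd \<Rightarrow> real"
    and \<phi> \<psi>\<^sub>0 \<phi>\<^sub>0 :: "real ^ 'd \<Rightarrow> real"
    and g a b k :: "real \<Rightarrow> real"
    and H \<alpha> lam0 C \<beta> :: real
    and M :: "'w measure"
    and F :: "real \<Rightarrow> 'w measure"
    and B BH N :: "real \<Rightarrow> 'w \<Rightarrow> real"
    and u v :: "real \<Rightarrow> 'w \<Rightarrow> real ^ 'd \<Rightarrow> real"
    and \<tau> \<tau>star :: "'w \<Rightarrow> ereal"
  assumes D: "bounded D" "lipschitz_domain D"
    and semigroup: "contraction_semigroup D P" "L = generator D P"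
    and adjoint: "contraction_semigroup D Ps" "Ls = adjoint_op D L" "Ls = generator D Ps"
      "\<forall>t\<ge>0. \<forall>f\<in>L2 D. \<forall>h\<in>L2 D. L2_inner D (P t f) h = L2_inner D f (Ps t h)"
    and densities: "transition_density D P p" "transition_density D Ps (\<lambda>t x y. p t y x)"
    and \<phi>: "\<phi> \<in> Linfty D" "AE x\<in>D in lborel. 0 \<le> \<phi> x"
    and g: "local_lipschitz (UNIV :: real set) UNIV (\<lambda>_. g)" "\<forall>z. 0 \<le> g z"
    and filtered: "filtered_prob_space M F"
    and B: "brownian_motion M F B"
    and H: "1 / 2 < H" "H < 1"
    and BH: "fractional_brownian_motion M H BH" "adapted F BH"
    and a: "continuous_on {0..} a"
    and b: "\<alpha> > 1 - H" "\<forall>T>0. holder_on \<alpha> {0..T} b"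
    and k: "\<forall>t\<ge>0. set_integrable lborel {0..t} (\<lambda>r. (k r)\<^sup>2)"
    and N: "mixed_noise M F B BH a b N"
    and u: "weak_solution_spde M F D Ls k a b g H B BH \<phi> \<tau> u"
    and v: "weak_solution_random_pde M F D Ls k a g N \<phi> \<tau> v"
    and uv: "AE \<omega> in M. \<forall>t\<ge>0. ereal t < \<tau> \<omega> \<longrightarrow> (\<forall>x\<in>D. v t \<omega> x = exp (- N t \<omega>) * u t \<omega> x)"
    and \<tau>: "blowup_time M F D u \<tau>"
    and lam0: "lam0 > 0"
    and \<psi>\<^sub>0: "\<psi>\<^sub>0 \<in> op_dom L" "\<forall>x\<in>D. 0 < \<psi>\<^sub>0 x" "(LINT x:D|lborel. \<psi>\<^sub>0 x) = 1"
      "\<forall>t\<ge>0. eq_ae D (P t \<psi>\<^sub>0) (\<lambda>x. exp (- lam0 * t) * \<psi>\<^sub>0 x)"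
    and \<phi>\<^sub>0: "\<phi>\<^sub>0 \<in> op_dom Ls" "\<forall>x\<in>D. 0 < \<phi>\<^sub>0 x" "(LINT x:D|lborel. \<phi>\<^sub>0 x) = 1"
      "\<forall>t\<ge>0. eq_ae D (Ps t \<phi>\<^sub>0) (\<lambda>x. exp (- lam0 * t) * \<phi>\<^sub>0 x)"
    and C\<beta>: "C > 0" "\<beta> > 0" "\<forall>z>0. g z \<ge> C * z powr (1 + \<beta>)"
    and \<tau>star: "\<forall>\<omega>. \<tau>star \<omega> = Inf {ereal t | t. t > 0 \<and>
      ereal (LINT r:{0..t}|lborel.
        exp (- \<beta> * (lam0 * half_sq_integral k r + half_sq_integral a r) + \<beta> * N r \<omega>))
      \<ge> ereal (1 / (C * \<beta>)) * neg_power (L2_inner D \<phi> \<phi>\<^sub>0) \<beta>}"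
  shows "AE \<omega> in M. \<tau>star \<omega> < \<infinity> \<longrightarrow>
    \<tau> \<omega> < \<infinity> \<and>
    blows_up_at D (\<lambda>t. v t \<omega>) (real_of_ereal (\<tau> \<omega>)) \<and>
    blows_up_at D (\<lambda>t. u t \<omega>) (real_of_ereal (\<tau> \<omega>)) \<and>
    \<tau> \<omega> \<le> \<tau>star \<omega>"
proof -
  have \<phi>\<^sub>0_L2: "\<phi>\<^sub>0 \<in> L2 D"
    using \<phi>\<^sub>0(1) adjoint(3) by (auto simp: op_dom_def generator_def)
  have \<phi>\<^sub>0_int: "set_integrable lborel D \<phi>\<^sub>0"
    using \<phi>\<^sub>0(3) not_integrable_integral_eq
    by (fastforce simp: set_integrable_def set_lebesgue_integral_def)
  have eigen: "Ls \<phi>\<^sub>0 (\<lambda>x. - lam0 * \<phi>\<^sub>0 x)"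
    unfolding adjoint(3) by (rule generator_eigenfunction[OF adjoint(1) \<phi>\<^sub>0_L2 \<phi>\<^sub>0(4)])
  define y0 where "y0 = L2_inner D \<phi> \<phi>\<^sub>0"
  have y0: "0 \<le> y0"
    unfolding y0_def L2_inner_def set_lebesgue_integral_def
    by (rule integral_nonneg_AE)
      (use \<phi>(2) \<phi>\<^sub>0(2) in \<open>auto split: split_indicator elim!: eventually_mono intro: mult_nonneg_nonneg less_imp_le\<close>)
  define q where "q = (\<lambda>s. lam0 * ((k s)\<^sup>2 / 2) + (a s)\<^sup>2 / 2)"
  have q_nonneg: "0 \<le> q s" for s
    using lam0 by (simp add: q_def)
  have a_int: "set_integrable lborel {0..t} (\<lambda>s. (a s)\<^sup>2)" for t
    by (intro borel_integrable_atLeastAtMost' continuous_intros continuous_on_subset[OF a]) auto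
  have q_int: "set_integrable lborel {0..t} q" if "0 \<le> t" for t
    unfolding q_def using k that a_int by (intro set_integral_add set_integrable_mult_right
        set_integrable_divide) auto
  have q_integral: "lam0 * half_sq_integral k t + half_sq_integral a t = integral {0..t} q"
    if "0 \<le> t" for t
  proof -
    have "(LINT s:{0..t}|lborel. q s) = lam0 * half_sq_integral k t + half_sq_integral a t"
      unfolding q_def half_sq_integral_def using k that a_int
      by (subst set_integral_add) (auto intro!: set_integrable_mult_right set_integrable_divide)
    then show ?thesis
      using set_borel_integral_eq_integral(2)[OF q_int[OF that]] by simp
  qed
  have N_cont: "AE \<omega> in M. continuous_on {0..} (\<lambda>t. N t \<omega>)"
    using N by (simp add: mixed_noise_def continuous_paths_def)
  have v_L2: "v t \<omega> \<in> L2 D" if "0 \<le> t" "\<omega> \<in> space M" "ereal t < \<tau> \<omega>" for t \<omega>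
    using v that by (auto simp: weak_solution_random_pde_def adapted_L2_field_def)
  define y where "y = (\<lambda>\<omega> s. L2_inner D (v s \<omega>) \<phi>\<^sub>0)"
  define G where "G = (\<lambda>\<omega> s. exp (- N s \<omega>) * L2_inner D (\<lambda>x. g (exp (N s \<omega>) * v s \<omega> x)) \<phi>\<^sub>0)"
  have linear: "(k s)\<^sup>2 / 2 * L2_inner D (v s \<omega>) (\<lambda>x. - lam0 * \<phi>\<^sub>0 x)
      - (a s)\<^sup>2 / 2 * L2_inner D (v s \<omega>) \<phi>\<^sub>0 = - (q s * y \<omega> s)" for s \<omega>
  proof -
    have "L2_inner D (v s \<omega>) (\<lambda>x. - lam0 * \<phi>\<^sub>0 x) = (LINT x:D|lborel. - lam0 * (v s \<omega> x * \<phi>\<^sub>0 x))"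
      unfolding L2_inner_def by (simp add: mult_ac)
    also have "\<dots> = - lam0 * y \<omega> s"
      unfolding y_def L2_inner_def by (rule set_integral_mult_right)
    finally show ?thesis by (simp add: q_def y_def algebra_simps)
  qed
  \<comment> \<open>The exceptional null set of the weak formulation depends on the time horizon; countably many
    horizons \<open>Suc n\<close> cover all times.\<close>
  have "AE \<omega> in M. \<forall>n. \<forall>t. 0 < t \<and> ereal t < min (ereal (real (Suc n))) (\<tau> \<omega>) \<longrightarrow>
      set_integrable lborel {0..t} (\<lambda>s. - (q s * y \<omega> s)) \<and>
      (AE s\<in>{0..t} in lborel. set_integrable lborel D (\<lambda>x. g (exp (N s \<omega>) * v s \<omega> x) * \<phi>\<^sub>0 x)) \<and>
      set_integrable lborel {0..t} (G \<omega>) \<and>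
      y \<omega> t = y0 + (LINT s:{0..t}|lborel. - (q s * y \<omega> s)) + (LINT s:{0..t}|lborel. G \<omega> s)"
    unfolding AE_all_countable
  proof
    fix n
    have "real (Suc n) > 0" by simp
    with v eigen show "AE \<omega> in M. \<forall>t. 0 < t \<and> ereal t < min (ereal (real (Suc n))) (\<tau> \<omega>) \<longrightarrow>
      set_integrable lborel {0..t} (\<lambda>s. - (q s * y \<omega> s)) \<and>
      (AE s\<in>{0..t} in lborel. set_integrable lborel D (\<lambda>x. g (exp (N s \<omega>) * v s \<omega> x) * \<phi>\<^sub>0 x)) \<and>
      set_integrable lborel {0..t} (G \<omega>) \<and>
      y \<omega> t = y0 + (LINT s:{0..t}|lborel. - (q s * y \<omega> s)) + (LINT s:{0..t}|lborel. G \<omega> s)"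
      unfolding weak_solution_random_pde_def linear[symmetric] unfolding y_def G_def y0_def by blast
  qed
  moreover have "AE \<omega> in M. 0 < \<tau> \<omega> \<and>
      (\<tau> \<omega> < \<infinity> \<longrightarrow> blows_up_at D (\<lambda>t. u t \<omega>) (real_of_ereal (\<tau> \<omega>)))"
    using \<tau> by (simp add: blowup_time_def)
  ultimately show ?thesis
    using N_cont uv AE_space
  proof eventually_elim
    case (elim \<omega>)
    define h where "h = (\<lambda>r. exp (- \<beta> * (lam0 * half_sq_integral k r + half_sq_integral a r) + \<beta> * N r \<omega>))"
    define A where "A = {ereal t | t. t > 0 \<and>
        ereal (LINT r:{0..t}|lborel. h r) \<ge> ereal (1 / (C * \<beta>)) * neg_power y0 \<beta>}"
    have \<tau>star_A: "\<tau>star \<omega> = Inf A"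
      using \<tau>star by (simp add: A_def h_def y0_def)
    have N_on: "continuous_on {0..t} (\<lambda>t. N t \<omega>)" for t
      by (rule continuous_on_subset[OF elim(3)]) auto
    have upper: "\<tau> \<omega> \<le> ereal t"
      if t: "0 < t" and ge: "ereal (LINT r:{0..t}|lborel. h r) \<ge> ereal (1 / (C * \<beta>)) * neg_power y0 \<beta>" for t
    proof (rule ccontr)
      assume "\<not> \<tau> \<omega> \<le> ereal t"
      then have t\<tau>: "ereal t < \<tau> \<omega>" by simp
      \<comment> \<open>For \<open>y0 = 0\<close> the threshold is infinite and cannot be reached by a real number.\<close>
      have y0_pos: "0 < y0"
        using ge y0 C\<beta>(1,2) by (cases "y0 = 0") (auto simp: neg_power_def)
      have eqs: "set_integrable lborel {0..s} (\<lambda>s. - (q s * y \<omega> s))"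
          "AE r\<in>{0..s} in lborel. set_integrable lborel D (\<lambda>x. g (exp (N r \<omega>) * v r \<omega> x) * \<phi>\<^sub>0 x)"
          "set_integrable lborel {0..s} (G \<omega>)"
          "y \<omega> s = y0 + (LINT s:{0..s}|lborel. - (q s * y \<omega> s)) + (LINT s:{0..s}|lborel. G \<omega> s)"
        if "0 < s" "s \<le> t" for s
      proof -
        obtain n where "s < real n" using reals_Archimedean2 by blast
        then have "s < real (Suc n)" by simp
        moreover have "ereal s < \<tau> \<omega>"
          using that(2) t\<tau> by (meson ereal_less_eq(3) order_le_less_trans)
        ultimately have "0 < s \<and> ereal s < min (ereal (real (Suc n))) (\<tau> \<omega>)"
          using that by simp
        then show "set_integrable lborel {0..s} (\<lambda>s. - (q s * y \<omega> s))"
          "AE r\<in>{0..s} in lborel. set_integrable lborel D (\<lambda>x. g (exp (N r \<omega>) * v r \<omega> x) * \<phi>\<^sub>0 x)"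
          "set_integrable lborel {0..s} (G \<omega>)"
          "y \<omega> s = y0 + (LINT s:{0..s}|lborel. - (q s * y \<omega> s)) + (LINT s:{0..s}|lborel. G \<omega> s)"
          using elim(1) by blast+
      qed
      have "C * \<beta> * integral {0..t} (\<lambda>s. exp (- \<beta> * integral {0..s} q + \<beta> * N s \<omega>)) < y0 powr (- \<beta>)"
      proof (rule weak_supersolution_bound[OF t C\<beta>(1,2) y0_pos])
        show "set_integrable lborel {0..t} q" using q_int t by simp
        show "0 \<le> q s" for s by (rule q_nonneg)
        show "continuous_on {0..t} (\<lambda>t. N t \<omega>)" by (rule N_on)
        show "set_integrable lborel {0..t} (\<lambda>s. q s * y \<omega> s)"
          using eqs(1)[OF t] by (simp add: set_integrable_def)
        show "set_integrable lborel {0..t} (G \<omega>)" using eqs(3)[OF t] by simp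
        show "0 \<le> G \<omega> s" if "s \<in> {0..t}" for s
          unfolding G_def L2_inner_def set_lebesgue_integral_def
          using g(2) \<phi>\<^sub>0(2)
          by (intro mult_nonneg_nonneg Bochner_Integration.integral_nonneg)
            (auto simp: less_imp_le split: split_indicator)
        show "AE s\<in>{0..t} in lborel. 0 < y \<omega> s \<longrightarrow>
            C * exp (\<beta> * N s \<omega>) * y \<omega> s powr (1 + \<beta>) \<le> G \<omega> s"
          using eqs(2)[OF t order_refl]
        proof eventually_elim
          case (elim s)
          show ?case
          proof (intro impI)
            assume s: "s \<in> {0..t}" and pos: "0 < y \<omega> s"
            have "ereal s < \<tau> \<omega>"
              using s t\<tau> by (meson atLeastAtMost_iff ereal_less_eq(3) order_le_less_trans)
            then have "v s \<omega> \<in> L2 D"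
              using s \<open>\<omega> \<in> space M\<close> by (intro v_L2) auto
            then have "set_integrable lborel D (\<lambda>x. v s \<omega> x * \<phi>\<^sub>0 x)"
              by (rule L2_mult_integrable[OF _ \<phi>\<^sub>0_L2])
            then show "C * exp (\<beta> * N s \<omega>) * y \<omega> s powr (1 + \<beta>) \<le> G \<omega> s"
              unfolding y_def G_def
            proof (intro superlinear_jensen[OF C\<beta>(1,2) _ _ \<phi>\<^sub>0_int \<phi>\<^sub>0(3)])
              show "set_integrable lborel D (\<lambda>x. g (exp (N s \<omega>) * v s \<omega> x) * \<phi>\<^sub>0 x)"
                using elim s by simp
              show "0 < L2_inner D (v s \<omega>) \<phi>\<^sub>0" using pos by (simp add: y_def)
            qed (use C\<beta>(3) g(2) \<phi>\<^sub>0(2) in \<open>simp_all add: less_imp_le\<close>)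
          qed
        qed
        show "y \<omega> s = y0 - (LINT s:{0..s}|lborel. q s * y \<omega> s) + (LINT s:{0..s}|lborel. G \<omega> s)"
          if "0 < s" "s \<le> t" for s
          using eqs(4)[OF that] by (simp add: set_lebesgue_integral_def)
      qed
      moreover have "integral {0..t} (\<lambda>s. exp (- \<beta> * integral {0..s} q + \<beta> * N s \<omega>)) = (LINT r:{0..t}|lborel. h r)"
      proof -
        have "continuous_on {0..t} (\<lambda>s. exp (- \<beta> * integral {0..s} q + \<beta> * N s \<omega>))"
          using set_borel_integral_eq_integral(1)[OF q_int] t
          by (intro continuous_intros N_on indefinite_integral_continuous_1) auto
        then have "set_integrable lborel {0..t} (\<lambda>s. exp (- \<beta> * integral {0..s} q + \<beta> * N s \<omega>))"
          by (rule borel_integrable_atLeastAtMost')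
        then have "integral {0..t} (\<lambda>s. exp (- \<beta> * integral {0..s} q + \<beta> * N s \<omega>))
            = (LINT s:{0..t}|lborel. exp (- \<beta> * integral {0..s} q + \<beta> * N s \<omega>))"
          by (rule set_borel_integral_eq_integral(2)[symmetric])
        also have "\<dots> = (LINT r:{0..t}|lborel. h r)"
          by (rule set_lebesgue_integral_cong) (auto simp: h_def q_integral)
        finally show ?thesis .
      qed
      ultimately have "(LINT r:{0..t}|lborel. h r) < 1 / (C * \<beta>) * y0 powr (- \<beta>)"
        using C\<beta> by (simp add: field_simps)
      then show False
        using ge y0_pos by (simp add: neg_power_def)
    qed
    have le: "\<tau> \<omega> \<le> \<tau>star \<omega>"
      unfolding \<tau>star_A by (rule Inf_greatest) (use upper in \<open>auto simp: A_def\<close>)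
    show ?case
    proof
      assume fin: "\<tau>star \<omega> < \<infinity>"
      have \<tau>_fin: "\<tau> \<omega> < \<infinity>" using le fin by (rule order_le_less_trans)
      then obtain T where T: "\<tau> \<omega> = ereal T" "0 < T"
        using elim(2) by (cases "\<tau> \<omega>") auto
      have bu: "blows_up_at D (\<lambda>t. u t \<omega>) T" using elim(2) T by auto
      have "blows_up_at D (\<lambda>t. v t \<omega>) T"
        by (rule blows_up_at_rescale[OF T(2) N_on _ bu]) (use elim(4) T in auto)
      with bu le \<tau>_fin T show "\<tau> \<omega> < \<infinity> \<and>
          blows_up_at D (\<lambda>t. v t \<omega>) (real_of_ereal (\<tau> \<omega>)) \<and>
          blows_up_at D (\<lambda>t. u t \<omega>) (real_of_ereal (\<tau> \<omega>)) \<and>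
          \<tau> \<omega> \<le> \<tau>star \<omega>" by simp
    qed
  qed
qed

end
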